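(* Let $P_n$ and $C_n$ denote the path and the cycle on $n\ge 2$ vertices (for $C_n$, $n\ge 3$). Then $\chi_g''(P_n)=\chi_{gl}''(P_n)=3$ and $\chi_g''(C_n)=\chi_{gl}''(C_n)=4$.
   Context: All graphs are finite and simple. Let $H$ be a graph with an arbitrary fixed orientation and $A$ a group written additively. For $f:E(H)\to A$ and a list assignment $L:V(H)\to 2^A$, an $(A,L,f)$-coloring of $H$ is a map $c:V(H)\to A$ with $c(v)\in L(v)$ for all $v$ and $c(x)-c(y)\neq f(xy)$ for every edge directed from $x$ to $y$. $H$ is $k$-group choosable if for every group $A$ with $|A|\ge k$, every list assignment $L$ with $|L(v)|=k$ for all $v$, and every $f:E(H)\to A$, an $(A,L,f)$-coloring exists; $\chi_{gl}(H)$ is the least such $k$. $H$ is $A$-colorable if for every $f:E(H)\to A$ there is $c:V(H)\to A$ with $c(x)-c(y)\ne f(xy)$ for every edge directed from $x$ to $y$; $\chi_g(H)$ is the least $k$ such that $H$ is $A$-colorable for every group $A$ with $|A|\ge k$. The total graph $T(G)$ has vertex set $V(G)\cup E(G)$, two elements adjacent iff they are adjacent or incident in $G$; $\chi_{gl}''(G)=\chi_{gl}(T(G))$ and $\chi_g''(G)=\chi_g(T(G))$. *)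

theory Defs
  imports "HOL-Algebra.Group"
begin

record 'v sgraph =
  verts :: "'v set"
  edges :: "'v set set"

definition simple_graph :: "'v sgraph \<Rightarrow> bool" where
  "simple_graph H \<longleftrightarrow>
     finite (verts H) \<and> (\<forall>e \<in> edges H. e \<subseteq> verts H \<and> card e = 2)"

definition path_graph :: "nat \<Rightarrow> nat sgraph" where
  "path_graph n = \<lparr> verts = {..<n}, edges = {{i, Suc i} |i. Suc i < n} \<rparr>"

text \<open>Only meant for \<open>n \<ge> 3\<close>; for smaller \<open>n\<close> this is not a cycle.\<close>

definition cycle_graph :: "nat \<Rightarrow> nat sgraph" where
  "cycle_graph n = \<lparr> verts = {..<n}, edges = {{i, Suc i mod n} |i. i < n} \<rparr>"

definition total_graph :: "'v sgraph \<Rightarrow> ('v + 'v set) sgraph" where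
  "total_graph G =
     \<lparr> verts = verts G <+> edges G,
       edges = {{Inl u, Inl v} |u v. {u, v} \<in> edges G}
             \<union> {{Inl v, Inr e} |v e. e \<in> edges G \<and> v \<in> e}
             \<union> {{Inr e, Inr e'} |e e'. e \<in> edges G \<and> e' \<in> edges G \<and> e \<noteq> e' \<and> e \<inter> e' \<noteq> {}} \<rparr>"

definition orientation :: "'v sgraph \<Rightarrow> ('v \<times> 'v) set \<Rightarrow> bool" where
  "orientation H D \<longleftrightarrow>
     (\<forall>(x, y) \<in> D. {x, y} \<in> edges H) \<and>
     (\<forall>x y. {x, y} \<in> edges H \<longrightarrow> ((x, y) \<in> D \<longleftrightarrow> (y, x) \<notin> D))"

text \<open>
  Groups are arbitrary, not necessarily commutative. In the multiplicative notation of the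
  library, the difference \<open>c(x) - c(y)\<close> is \<open>c x \<otimes> inv (c y)\<close>.
\<close>

definition group_coloring ::
  "'v sgraph \<Rightarrow> ('v \<times> 'v) set \<Rightarrow> 'a monoid \<Rightarrow> ('v set \<Rightarrow> 'a) \<Rightarrow> ('v \<Rightarrow> 'a) \<Rightarrow> bool" where
  "group_coloring H D A f c \<longleftrightarrow>
     c \<in> verts H \<rightarrow> carrier A \<and>
     (\<forall>(x, y) \<in> D. c x \<otimes>\<^bsub>A\<^esub> inv\<^bsub>A\<^esub> (c y) \<noteq> f {x, y})"

definition list_group_coloring ::
  "'v sgraph \<Rightarrow> ('v \<times> 'v) set \<Rightarrow> 'a monoid \<Rightarrow> ('v \<Rightarrow> 'a set) \<Rightarrow> ('v set \<Rightarrow> 'a) \<Rightarrow> ('v \<Rightarrow> 'a) \<Rightarrow> bool"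
  where
  "list_group_coloring H D A L f c \<longleftrightarrow>
     group_coloring H D A f c \<and> (\<forall>v \<in> verts H. c v \<in> L v)"

definition group_colorable :: "'v sgraph \<Rightarrow> ('v \<times> 'v) set \<Rightarrow> 'a monoid \<Rightarrow> bool" where
  "group_colorable H D A \<longleftrightarrow>
     (\<forall>f \<in> edges H \<rightarrow> carrier A. \<exists>c. group_coloring H D A f c)"

definition order_ge :: "'a monoid \<Rightarrow> nat \<Rightarrow> bool" where
  "order_ge A k \<longleftrightarrow> infinite (carrier A) \<or> k \<le> card (carrier A)"

text \<open>
  Quantification over all groups is quantification over all groups whose carrier is a subset of
  a type \<open>'a\<close>, which is passed as an explicit argument. The carrier can be any subset of \<open>'a\<close>,
  so an infinite \<open>'a\<close> contains isomorphic copies of all finite groups, and of all groups of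
  cardinality up to that of \<open>'a\<close>. Leaving \<open>'a\<close> an arbitrary infinite type covers all groups.
\<close>

definition group_choosable ::
  "'a itself \<Rightarrow> 'v sgraph \<Rightarrow> ('v \<times> 'v) set \<Rightarrow> nat \<Rightarrow> bool" where
  "group_choosable TA H D k \<longleftrightarrow>
     (\<forall>A :: 'a monoid. group A \<longrightarrow> order_ge A k \<longrightarrow>
       (\<forall>L f. (\<forall>v \<in> verts H. L v \<subseteq> carrier A \<and> finite (L v) \<and> card (L v) = k) \<longrightarrow>
              f \<in> edges H \<rightarrow> carrier A \<longrightarrow>
              (\<exists>c. list_group_coloring H D A L f c)))"

definition group_choice_number ::
  "'a itself \<Rightarrow> 'v sgraph \<Rightarrow> ('v \<times> 'v) set \<Rightarrow> nat" where
  "group_choice_number TA H D = (LEAST k. group_choosable TA H D k)"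

definition group_chromatic_number ::
  "'a itself \<Rightarrow> 'v sgraph \<Rightarrow> ('v \<times> 'v) set \<Rightarrow> nat" where
  "group_chromatic_number TA H D =
     (LEAST k. \<forall>A :: 'a monoid. group A \<longrightarrow> order_ge A k \<longrightarrow> group_colorable H D A)"

text \<open>In the total versions, \<open>D\<close> is an orientation of the total graph.\<close>

definition total_group_choice_number ::
  "'a itself \<Rightarrow> 'v sgraph \<Rightarrow> (('v + 'v set) \<times> ('v + 'v set)) set \<Rightarrow> nat" where
  "total_group_choice_number TA G D = group_choice_number TA (total_graph G) D"

definition total_group_chromatic_number ::
  "'a itself \<Rightarrow> 'v sgraph \<Rightarrow> (('v + 'v set) \<times> ('v + 'v set)) set \<Rightarrow> nat" where
  "total_group_chromatic_number TA G D = group_chromatic_number TA (total_graph G) D"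

lemma simple_graph_path: "simple_graph (path_graph n)"
  by (auto simp: simple_graph_def path_graph_def card_insert_if)

lemma simple_graph_cycle:
  assumes "n \<ge> 3"
  shows "simple_graph (cycle_graph n)"
proof -
  have "i \<noteq> Suc i mod n" if "i < n" for i
    using assms that by (cases "Suc i = n") auto
  then show ?thesis
    using assms by (auto simp: simple_graph_def cycle_graph_def card_insert_if)
qed

lemma simple_graph_total:
  assumes "simple_graph G"
  shows "simple_graph (total_graph G)"
proof -
  have "edges G \<subseteq> Pow (verts G)" and fin: "finite (verts G)"
    using assms by (auto simp: simple_graph_def)
  then have "finite (edges G)"
    using finite_subset by auto
  moreover have ends: "u \<noteq> v \<and> u \<in> verts G \<and> v \<in> verts G" if "{u, v} \<in> edges G" for u v
    using assms that by (cases "u = v") (auto simp: simple_graph_def)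
  moreover have "v \<in> verts G" if "e \<in> edges G" "v \<in> e" for v e
    using assms that by (auto simp: simple_graph_def)
  ultimately show ?thesis
    unfolding simple_graph_def total_graph_def using fin
    by (auto simp: card_2_iff doubleton_eq_iff dest: ends)
qed

lemma orientation_exists:
  fixes H :: "'v sgraph"
  assumes "simple_graph H"
  shows "\<exists>D. orientation H D"
proof -
  have "\<exists>p. {fst p, snd p} = e" if "e \<in> edges H" for e
  proof -
    have "card e = 2" using assms that by (auto simp: simple_graph_def)
    then obtain x y where "e = {x, y}" by (auto simp: card_2_iff)
    then have "{fst (x, y), snd (x, y)} = e" by simp
    then show ?thesis by blast
  qed
  then obtain p where p: "\<And>e. e \<in> edges H \<Longrightarrow> {fst (p e), snd (p e)} = e"
    by metis
  have ne: "x \<noteq> y" if "{x, y} \<in> edges H" for x y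
    using assms that by (cases "x = y") (auto simp: simple_graph_def)
  have mem: "p {x, y} = (x, y) \<and> {x, y} \<in> edges H" if xy: "(x, y) \<in> p ` edges H" for x y
  proof -
    obtain e where e: "e \<in> edges H" "p e = (x, y)" using xy by auto
    then have "e = {x, y}" using p[OF e(1)] by simp
    with e show ?thesis by simp
  qed
  have "(x, y) \<in> p ` edges H \<longleftrightarrow> (y, x) \<notin> p ` edges H" if e: "{x, y} \<in> edges H" for x y
  proof -
    have cases: "p {x, y} = (x, y) \<or> p {x, y} = (y, x)"
      using p[OF e] by (cases "p {x, y}") (auto simp: doubleton_eq_iff)
    have "p {x, y} \<in> p ` edges H" using e by (rule imageI)
    with cases have "(x, y) \<in> p ` edges H \<or> (y, x) \<in> p ` edges H" by auto
    moreover have "\<not> ((x, y) \<in> p ` edges H \<and> (y, x) \<in> p ` edges H)"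
    proof
      assume "(x, y) \<in> p ` edges H \<and> (y, x) \<in> p ` edges H"
      then have "p {x, y} = (x, y)" "p {y, x} = (y, x)" using mem by blast+
      moreover have "{y, x} = {x, y}" by (rule insert_commute)
      ultimately show False using ne[OF e] by simp
    qed
    ultimately show ?thesis by blast
  qed
  then have "orientation H (p ` edges H)"
    using mem unfolding orientation_def by fast
  then show ?thesis ..
qed

end

theory Submission
  imports Defs
begin

text \<open>
  Listing vertices and edges alternately turns \<open>T(P\<^sub>n)\<close> into the square of a path on \<open>2n - 1\<close>
  vertices and \<open>T(C\<^sub>n)\<close> into the square of a cycle on \<open>2n\<close> vertices. For fixed labels, each
  edge constraint is a matching between the two colour lists, so the upper bounds only need greedy
  colouring against matchings, with Brooks' trick for the cycle. The lower bounds use the groups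
  \<open>\<int>\<^sub>2\<close> and \<open>\<int>\<^sub>3\<close>.
\<close>

section \<open>Colourings avoiding matchings\<close>

text \<open>This is correspondence (DP) colouring. With symmetry, \<open>conflict_unique\<close>
  makes the clashes between two lists a partial matching. Adjacency enters only through
  \<open>K\<close>.\<close>

locale correspondence =
  fixes V :: "'v set" and L :: "'v \<Rightarrow> 'c set" and K :: "'v \<Rightarrow> 'c \<Rightarrow> 'v \<Rightarrow> 'c \<Rightarrow> bool"
  assumes finite_list: "x \<in> V \<Longrightarrow> finite (L x)"
    and conflict_sym: "K x a y b \<Longrightarrow> K y b x a"
    and conflict_irrefl: "\<not> K x a x b"
    and conflict_unique: "\<lbrakk>x \<in> V; y \<in> V; a \<in> L x; a' \<in> L x; b \<in> L y; K x a y b; K x a' y b\<rbrakk> \<Longrightarrow> a = a'"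
begin

definition proper :: "'v set \<Rightarrow> ('v \<Rightarrow> 'c) \<Rightarrow> bool" where
  "proper S c \<longleftrightarrow> (\<forall>x\<in>S. c x \<in> L x) \<and> (\<forall>x\<in>S. \<forall>y\<in>S. \<not> K x (c x) y (c y))"

lemma card_forbidden_le_1:
  assumes "x \<in> V" "y \<in> V" "b \<in> L y"
  shows "card {a \<in> L x. K x a y b} \<le> 1"
  using assms conflict_unique by (auto simp: card_le_Suc0_iff_eq finite_list)

lemma proper_insert:
  assumes "proper S c" "x \<notin> S" "a \<in> L x" "\<And>y. y \<in> S \<Longrightarrow> \<not> K x a y (c y)"
  shows "proper (insert x S) (c(x := a))"
  unfolding proper_def
proof (intro conjI ballI)
  fix u assume u: "u \<in> insert x S"
  then show "(c(x := a)) u \<in> L u" using assms by (auto simp: proper_def)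
  fix v assume v: "v \<in> insert x S"
  show "\<not> K u ((c(x := a)) u) v ((c(x := a)) v)"
  proof (cases "u = x")
    case True
    then show ?thesis using v assms(4) conflict_irrefl by (cases "v = x") auto
  next
    case False
    then show ?thesis
      using u v assms(1) assms(4)[of u] conflict_sym[of u "c u" x a]
      by (cases "v = x") (auto simp: proper_def)
  qed
qed

text \<open>Each coloured neighbour blocks at most one colour of \<open>x\<close>. The set
  \<open>B\<close> bounds the coloured neighbours and may contain uncoloured points, which spares
  case distinctions when it is instantiated.\<close>

lemma greedy_step:
  assumes "proper S c" "x \<in> V" "S \<subseteq> V" "x \<notin> S"
    and B: "finite B" "card B < card (L x)"
    and far: "\<And>y a b. y \<in> S \<Longrightarrow> y \<notin> B \<Longrightarrow> \<not> K x a y b"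
  shows "\<exists>a. proper (insert x S) (c(x := a))"
proof -
  define F where "F = (\<Union>y \<in> B \<inter> S. {a \<in> L x. K x a y (c y)})"
  have "card F \<le> (\<Sum>y \<in> B \<inter> S. card {a \<in> L x. K x a y (c y)})"
    unfolding F_def using B by (intro card_UN_le) auto
  also have "\<dots> \<le> (\<Sum>y \<in> B \<inter> S. 1)"
    using assms by (intro sum_mono card_forbidden_le_1) (auto simp: proper_def)
  also have "\<dots> \<le> card B"
    using B by (simp add: card_mono)
  finally have "card F < card (L x)" using B by simp
  moreover have "F \<subseteq> L x" by (auto simp: F_def)
  ultimately have "F \<subset> L x" by auto
  then obtain a where "a \<in> L x" "a \<notin> F" by blast
  then have "\<not> K x a y (c y)" if "y \<in> S" for y
    using that far by (cases "y \<in> B") (auto simp: F_def)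
  with proper_insert assms \<open>a \<in> L x\<close> show ?thesis by blast
qed

text \<open>The analogue of giving two neighbours of \<open>x\<close> the same colour in the proof of Brooks' theorem.\<close>

lemma pair_forbidding_at_most_one:
  assumes V: "u \<in> V" "w \<in> V" "x \<in> V"
    and card: "card (L u) = k" "card (L w) = k" "card (L x) = k" "k > 0"
  shows "\<exists>a \<in> L u. \<exists>b \<in> L w. card {d \<in> L x. K x d u a \<or> K x d w b} \<le> 1"
proof -
  have ne: "L u \<noteq> {}" "L w \<noteq> {}" "L x \<noteq> {}" using card by auto
  \<comment> \<open>If every colour of \<open>v\<close> blocks some colour of \<open>x\<close>, the
    equal list sizes make the matching perfect, so every colour of \<open>x\<close> is blocked by
    some colour of \<open>v\<close>.\<close>
  have match: "\<exists>a \<in> L v. K x d v a"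
    if v: "v \<in> V" "card (L v) = k" and all: "\<forall>a \<in> L v. \<exists>d \<in> L x. K x d v a" and d: "d \<in> L x" for v d
  proof -
    obtain m where m: "\<And>a. a \<in> L v \<Longrightarrow> m a \<in> L x \<and> K x (m a) v a" using all by metis
    have "inj_on m (L v)"
      using m conflict_unique[OF v(1) V(3)] conflict_sym by (metis inj_onI)
    then have "card (m ` L v) = card (L x)" using v card by (simp add: card_image)
    then have "m ` L v = L x"
      using m finite_list V by (intro card_subset_eq) auto
    then obtain a where "a \<in> L v" "d = m a" using d by blast
    with m show ?thesis by blast
  qed
  show ?thesis
  \<comment> \<open>A colour of \<open>u\<close> or \<open>w\<close> that blocks nothing at
    \<open>x\<close> leaves only the other vertex to block. Otherwise both matchings are perfect,
    and \<open>a\<close>, \<open>b\<close> can be chosen to block the same colour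
    \<open>d\<close>.\<close>
  proof (cases "\<exists>a \<in> L u. \<forall>d \<in> L x. \<not> K x d u a")
    case True
    then obtain a where a: "a \<in> L u" "\<forall>d \<in> L x. \<not> K x d u a" by blast
    obtain b where b: "b \<in> L w" using ne by blast
    have "{d \<in> L x. K x d u a \<or> K x d w b} = {d \<in> L x. K x d w b}" using a by blast
    with a b card_forbidden_le_1[OF V(3,2) b] show ?thesis by (intro bexI[of _ a] bexI[of _ b]) simp_all
  next
    case u: False
    show ?thesis
    proof (cases "\<exists>b \<in> L w. \<forall>d \<in> L x. \<not> K x d w b")
      case True
      then obtain b where b: "b \<in> L w" "\<forall>d \<in> L x. \<not> K x d w b" by blast
      obtain a where a: "a \<in> L u" using ne by blast
      have "{d \<in> L x. K x d u a \<or> K x d w b} = {d \<in> L x. K x d u a}" using b by blast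
      with a b card_forbidden_le_1[OF V(3,1) a] show ?thesis by (intro bexI[of _ a] bexI[of _ b]) simp_all
    next
      case w: False
      obtain d where d: "d \<in> L x" using ne by blast
      obtain a b where ab: "a \<in> L u" "K x d u a" "b \<in> L w" "K x d w b"
        using match[OF V(1) card(1) _ d] match[OF V(2) card(2) _ d] u w by blast
      have "{d \<in> L x. K x d u a \<or> K x d w b} \<subseteq> {d}"
        using ab d V conflict_unique by blast
      then have "card {d \<in> L x. K x d u a \<or> K x d w b} \<le> card {d}"
        by (intro card_mono) auto
      with ab show ?thesis by auto
    qed
  qed
qed

end

section \<open>Squares of paths and cycles under matching constraints\<close>

text \<open>Colouring from left to right, each vertex meets at most two coloured neighbours, fewer
  than its three colours.\<close>

lemma path_square_colouring:
  fixes L :: "nat \<Rightarrow> 'c set"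
  assumes "correspondence {..<N} L K"
    and card: "\<And>i. i < N \<Longrightarrow> card (L i) = 3"
    and near: "\<And>i j a b. \<lbrakk>i < N; j < N; K i a j b\<rbrakk> \<Longrightarrow> i \<le> j + 2"
  shows "\<exists>c. correspondence.proper L K {..<N} c"
proof -
  interpret correspondence "{..<N}" L K by fact
  have "m \<le> N \<Longrightarrow> \<exists>c. proper {..<m} c" for m
  proof (induction m)
    case 0
    then show ?case by (simp add: proper_def)
  next
    case (Suc m)
    then obtain c where "proper {..<m} c" by auto
    then have "\<exists>a. proper (insert m {..<m}) (c(m := a))"
    \<comment> \<open>For \<open>m < 2\<close> truncated subtraction sends both entries to
      \<open>0\<close>, which still covers every coloured neighbour.\<close>
    proof (rule greedy_step[where B = "{m - 1, m - 2}"])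
      show "card {m - 1, m - 2} < card (L m)"
        using card Suc.prems by (simp add: card_insert_if)
      show "\<not> K m a y b" if "y \<in> {..<m}" "y \<notin> {m - 1, m - 2}" for y a b
        using near[of m y a b] that Suc.prems by auto
    qed (use Suc.prems in auto)
    then show ?case by (auto simp: lessThan_Suc)
  qed
  then show ?thesis by blast
qed

text \<open>
  Vertices \<open>0\<close> and \<open>3\<close> are coloured first so that together they forbid at most one colour at their
  common neighbour \<open>2\<close>. In the order \<open>4, \<dots>, N - 1, 1\<close> every vertex still has an uncoloured
  neighbour when its turn comes, and \<open>2\<close> comes last.
\<close>

lemma cycle_square_colouring:
  fixes L :: "nat \<Rightarrow> 'c set"
  assumes "correspondence {..<N} L K" and N: "N \<ge> 6"
    and card: "\<And>i. i < N \<Longrightarrow> card (L i) = 4"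
    and near: "\<And>i j a b. \<lbrakk>i < N; j < N; K i a j b\<rbrakk> \<Longrightarrow>
                 i \<le> j + 2 \<and> j \<le> i + 2 \<or> i + N \<le> j + 2 \<or> j + N \<le> i + 2"
  shows "\<exists>c. correspondence.proper L K {..<N} c"
proof -
  interpret correspondence "{..<N}" L K by fact
  have "\<exists>a \<in> L 0. \<exists>b \<in> L 3. card {d \<in> L 2. K 2 d 0 a \<or> K 2 d 3 b} \<le> 1"
    using N card by (intro pair_forbidding_at_most_one[where k = 4]) auto
  then obtain a b where ab: "a \<in> L 0" "b \<in> L 3" "card {d \<in> L 2. K 2 d 0 a \<or> K 2 d 3 b} \<le> 1"
    by blast
  have step: "\<exists>c. proper (insert 0 {3..<4 + m}) c \<and> c 0 = a \<and> c 3 = b" if "4 + m \<le> N" for m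
    using that
  proof (induction m)
    case 0
    \<comment> \<open>Since \<open>N \<ge> 6\<close>, positions \<open>0\<close> and
      \<open>3\<close> are at cyclic distance at least three, so any two colours are
      compatible.\<close>
    have "\<not> K 0 a 3 b" "\<not> K 3 b 0 a"
      using near[of 0 3 a b] near[of 3 0 b a] N by auto
    moreover have "{3..<4 + 0} = {3::nat}" by auto
    ultimately show ?case
      using ab conflict_irrefl by (intro exI[of _ "(\<lambda>_. a)(3 := b)"]) (auto simp: proper_def)
  next
    case (Suc m)
    then obtain c where c: "proper (insert 0 {3..<4 + m}) c" "c 0 = a" "c 3 = b" by auto
    from c(1) have "\<exists>a. proper (insert (4 + m) (insert 0 {3..<4 + m})) (c(4 + m := a))"
    \<comment> \<open>From position \<open>4\<close> on, \<open>0\<close> is a possible neighbour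
      only at \<open>N - 2\<close> and \<open>N - 1\<close>. Listing it throughout still leaves one
      of four colours.\<close>
    proof (rule greedy_step[where B = "{3 + m, 2 + m, 0}"])
      show "card {3 + m, 2 + m, 0} < card (L (4 + m))"
        using card Suc.prems by (simp add: card_insert_if)
      show "\<not> K (4 + m) a y b"
        if "y \<in> insert 0 {3..<4 + m}" "y \<notin> {3 + m, 2 + m, 0}" for y a b
        using near[of "4 + m" y a b] that Suc.prems by auto
    qed (use Suc.prems in auto)
    then obtain d where "proper (insert (4 + m) (insert 0 {3..<4 + m})) (c(4 + m := d))" by blast
    moreover have "insert (4 + m) (insert 0 {3..<4 + m}) = insert 0 {3..<4 + Suc m}" by auto
    ultimately have "proper (insert 0 {3..<4 + Suc m}) (c(4 + m := d))" by (simp only:)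
    moreover have "(c(4 + m := d)) 0 = a" "(c(4 + m := d)) 3 = b" using c by simp_all
    ultimately show ?case by blast
  qed
  have "4 + (N - 4) = N" using N by simp
  then have "\<exists>c. proper (insert 0 {3..<N}) c \<and> c 0 = a \<and> c 3 = b"
    using step[of "N - 4"] by simp
  then obtain c where c: "proper (insert 0 {3..<N}) c" "c 0 = a" "c 3 = b" by blast
  from c(1) have "\<exists>e. proper (insert 1 (insert 0 {3..<N})) (c(1 := e))"
  \<comment> \<open>The remaining possible neighbour of \<open>1\<close>, namely \<open>2\<close>,
    is still uncoloured.\<close>
  proof (rule greedy_step[where B = "{N - 1, 0, 3}"])
    show "card {N - 1, 0, 3} < card (L 1)"
      using card[of 1] N by (simp add: card_insert_if)
    show "\<not> K 1 a y b" if "y \<in> insert 0 {3..<N}" "y \<notin> {N - 1, 0, 3}" for y a b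
      using near[of 1 y a b] that N by auto
  qed (use N in auto)
  then obtain e where e: "proper (insert 1 (insert 0 {3..<N})) (c(1 := e))" by blast
  define c' where "c' = c(1 := e)"
  have c': "proper (insert 1 (insert 0 {3..<N})) c'" "c' 0 = a" "c' 3 = b"
    using e c by (auto simp: c'_def)
  \<comment> \<open>Only \<open>0\<close>, \<open>1\<close>, \<open>3\<close>, \<open>4\<close> can
    block colours of \<open>2\<close>. By the choice of \<open>a\<close> and \<open>b\<close>, the
    pair \<open>0\<close>, \<open>3\<close> costs at most one colour, so at most three of four are
    lost.\<close>
  let ?X = "{d \<in> L 2. K 2 d 0 a \<or> K 2 d 3 b}" and ?Y = "\<lambda>j. {d \<in> L 2. K 2 d j (c' j)}"
  define F where "F = ?X \<union> ?Y 1 \<union> ?Y 4"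
  have Y: "card (?Y j) \<le> 1" if "j \<in> {1, 4}" for j
    using that c' N by (intro card_forbidden_le_1) (auto simp: proper_def)
  have "card F \<le> 3"
    unfolding F_def
    using ab(3) Y[of 1] Y[of 4] card_Un_le[of ?X "?Y 1"] card_Un_le[of "?X \<union> ?Y 1" "?Y 4"] by simp
  then have "card F < card (L 2)" using card[of 2] N by simp
  moreover have "F \<subseteq> L 2" by (auto simp: F_def)
  ultimately have "F \<subset> L 2" by auto
  then obtain d where d: "d \<in> L 2" "d \<notin> F" by blast
  have "\<not> K 2 d y (c' y)" if y: "y \<in> insert 1 (insert 0 {3..<N})" for y
  proof (cases "y \<in> {0, 1, 3, 4}")
    case True
    then show ?thesis using d c' by (auto simp: F_def)
  next
    case False
    then show ?thesis using near[of 2 y d "c' y"] y N by auto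
  qed
  then have "proper (insert 2 (insert 1 (insert 0 {3..<N}))) (c'(2 := d))"
    using d c' by (intro proper_insert) auto
  moreover have "insert 2 (insert 1 (insert 0 {3..<N})) = {..<N}" using N by auto
  ultimately show ?thesis by metis
qed

section \<open>Group colourings\<close>

text \<open>The two disjuncts make the relation symmetric in its two vertices, although each label
  is read along the orientation.\<close>

definition conflict ::
  "('v \<times> 'v) set \<Rightarrow> 'a monoid \<Rightarrow> ('v set \<Rightarrow> 'a) \<Rightarrow> 'v \<Rightarrow> 'a \<Rightarrow> 'v \<Rightarrow> 'a \<Rightarrow> bool" where
  "conflict D A f x a y b \<longleftrightarrow>
     (x, y) \<in> D \<and> a \<otimes>\<^bsub>A\<^esub> inv\<^bsub>A\<^esub> b = f {x, y} \<or> (y, x) \<in> D \<and> b \<otimes>\<^bsub>A\<^esub> inv\<^bsub>A\<^esub> a = f {x, y}"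

lemma conflict_edge:
  assumes "orientation H D" "conflict D A f x a y b"
  shows "{x, y} \<in> edges H"
proof -
  have "(x, y) \<in> D \<or> (y, x) \<in> D" using assms by (auto simp: conflict_def)
  then have "{x, y} \<in> edges H \<or> {y, x} \<in> edges H"
    using assms(1) unfolding orientation_def by fast
  then show ?thesis by (simp add: insert_commute)
qed

text \<open>The orientation selects one disjunct, so \<open>a\<close> and \<open>a'\<close> solve
  the same equation, and cancellation, valid in nonabelian groups too, identifies them.\<close>

lemma group_conflict_unique:
  assumes "group A" "orientation H D"
    and "a \<in> carrier A" "a' \<in> carrier A" "b \<in> carrier A"
    and "conflict D A f x a y b" "conflict D A f x a' y b"
  shows "a = a'"
proof -
  interpret group A by fact
  have "{x, y} \<in> edges H" using conflict_edge assms by metis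
  then have "(x, y) \<in> D \<longleftrightarrow> (y, x) \<notin> D" using assms(2) by (auto simp: orientation_def)
  then have "a \<otimes>\<^bsub>A\<^esub> inv\<^bsub>A\<^esub> b = a' \<otimes>\<^bsub>A\<^esub> inv\<^bsub>A\<^esub> b \<or> b \<otimes>\<^bsub>A\<^esub> inv\<^bsub>A\<^esub> a = b \<otimes>\<^bsub>A\<^esub> inv\<^bsub>A\<^esub> a'"
    using assms(6,7) unfolding conflict_def by metis
  then show ?thesis
    using assms(3-5) by (metis inv_closed inv_inv Units_eq Units_l_cancel right_cancel)
qed

text \<open>Moves the problem to positions \<open>{..<N}\<close>. Of the group and the labels only
  the matching property and the location of conflicts survive.\<close>

lemma group_choosableI:
  fixes H :: "'v sgraph" and p :: "nat \<Rightarrow> 'v"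
  assumes H: "simple_graph H" "orientation H D"
    and p: "verts H = p ` {..<N}"
    and colour: "\<And>(L :: nat \<Rightarrow> 'a set) K.
      \<lbrakk>correspondence {..<N} L K; \<And>i. i < N \<Longrightarrow> card (L i) = k;
        \<And>i j a b. K i a j b \<Longrightarrow> {p i, p j} \<in> edges H\<rbrakk> \<Longrightarrow> \<exists>c. correspondence.proper L K {..<N} c"
  shows "group_choosable TYPE('a) H D k"
  unfolding group_choosable_def
proof (intro allI impI)
  fix A :: "'a monoid" and L :: "'v \<Rightarrow> 'a set" and f
  assume A: "group A" "order_ge A k"
    and L: "\<forall>v \<in> verts H. L v \<subseteq> carrier A \<and> finite (L v) \<and> card (L v) = k"
  define L' K where "L' = (\<lambda>i. L (p i))" and "K = (\<lambda>i a j b. conflict D A f (p i) a (p j) b)"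
  have cov: "correspondence {..<N} L' K"
  proof
    show "finite (L' i)" if "i \<in> {..<N}" for i using that L p by (auto simp: L'_def)
    show "K j b i a" if "K i a j b" for i a j b
      using that by (auto simp: K_def conflict_def insert_commute)
    show "\<not> K i a i b" for i a b
    proof
      assume "K i a i b"
      then have "{p i, p i} \<in> edges H" unfolding K_def using conflict_edge H by metis
      then show False using H by (auto simp: simple_graph_def)
    qed
    show "a = a'" if "i \<in> {..<N}" "j \<in> {..<N}" "a \<in> L' i" "a' \<in> L' i" "b \<in> L' j" "K i a j b" "K i a' j b"
      for i j a a' b
    proof (rule group_conflict_unique[OF A(1) H(2)])
      show "conflict D A f (p i) a (p j) b" "conflict D A f (p i) a' (p j) b"
        using that by (auto simp: K_def)
    qed (use that L p in \<open>auto simp: L'_def\<close>)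
  qed
  obtain c where c: "correspondence.proper L' K {..<N} c"
    using colour[OF cov] L p conflict_edge[OF H(2)] by (fastforce simp: L'_def K_def)
  note c = c[unfolded correspondence.proper_def[OF cov]]
  \<comment> \<open>As \<open>p\<close> is onto the vertices, each vertex can take the colour of one
    chosen preimage.\<close>
  define q where "q = (\<lambda>v. SOME i. i < N \<and> p i = v)"
  have q: "q v < N \<and> p (q v) = v" if "v \<in> verts H" for v
    unfolding q_def by (rule someI_ex) (use that p in auto)
  have mem: "c (q v) \<in> L v" if "v \<in> verts H" for v
  proof -
    have "c (q v) \<in> L' (q v)" using c q[OF that] by blast
    then show ?thesis using q[OF that] by (simp add: L'_def)
  qed
  have "c (q x) \<otimes>\<^bsub>A\<^esub> inv\<^bsub>A\<^esub> (c (q y)) \<noteq> f {x, y}" if xy: "(x, y) \<in> D" for x y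
  proof -
    have "{x, y} \<in> edges H" using xy H by (auto simp: orientation_def)
    then have v: "x \<in> verts H" "y \<in> verts H" using H by (auto simp: simple_graph_def)
    then have "\<not> K (q x) (c (q x)) (q y) (c (q y))"
      using c q by blast
    then show ?thesis using xy q v by (simp add: K_def conflict_def)
  qed
  then have "list_group_coloring H D A L f (\<lambda>v. c (q v))"
    using mem L unfolding list_group_coloring_def group_coloring_def by blast
  then show "\<exists>c. list_group_coloring H D A L f c" by blast
qed

text \<open>Give every vertex the same list of \<open>k\<close> group elements.\<close>

lemma group_choosable_imp_colorable:
  fixes A :: "'a monoid"
  assumes "group_choosable TYPE('a) H D k" "group A" "order_ge A k"
  shows "group_colorable H D A"
proof -
  obtain M where "M \<subseteq> carrier A" "finite M" "card M = k"
    using assms(3) unfolding order_ge_def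
    by (metis infinite_arbitrarily_large obtain_subset_with_card_n)
  then have "\<exists>c. list_group_coloring H D A (\<lambda>_. M) f c" if "f \<in> edges H \<rightarrow> carrier A" for f
    using assms(1,2,3) that unfolding group_choosable_def by simp
  then show ?thesis unfolding group_colorable_def list_group_coloring_def by blast
qed

text \<open>Choosability bounds both numbers from above, and a single group of order
  \<open>k\<close> bounds both from below.\<close>

lemma group_numbers_eqI:
  fixes A :: "'a monoid"
  assumes ch: "group_choosable TYPE('a) H D (Suc k)"
    and A: "group A" "card (carrier A) = k" "\<not> group_colorable H D A"
  shows "group_chromatic_number TYPE('a) H D = Suc k \<and> group_choice_number TYPE('a) H D = Suc k"
proof -
  \<comment> \<open>Minimality requires every \<open>j \<le> k\<close> to fail, and \<open>A\<close>
    is large enough to be the counterexample for all of them.\<close>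
  have ge: "order_ge A j" if "\<not> Suc k \<le> j" for j using that A by (auto simp: order_ge_def)
  have "group_chromatic_number TYPE('a) H D = Suc k"
    unfolding group_chromatic_number_def
    using group_choosable_imp_colorable[OF ch] A ge by (intro Least_equality) blast+
  moreover have "group_choice_number TYPE('a) H D = Suc k"
    unfolding group_choice_number_def
    using group_choosable_imp_colorable[OF _ A(1)] A ch ge by (intro Least_equality) blast+
  ultimately show ?thesis by blast
qed

section \<open>Lower bounds from cyclic groups of orders 2 and 3\<close>

text \<open>A copy of the integers modulo \<open>m\<close> inside \<open>'a\<close>. The map
  \<open>\<epsilon>\<close> is the quotient map from all integers, so later arguments compute with
  integers and congruences.\<close>

lemma cyclic_group_on_infinite_type:
  assumes "infinite (UNIV :: 'a set)" "m > 0"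
  obtains A :: "'a monoid" and \<epsilon> :: "int \<Rightarrow> 'a"
  where "group A" "card (carrier A) = m" "carrier A = range \<epsilon>"
    "\<And>i j. \<epsilon> i \<otimes>\<^bsub>A\<^esub> inv\<^bsub>A\<^esub> (\<epsilon> j) = \<epsilon> (i - j)" "\<And>i j. \<epsilon> i = \<epsilon> j \<longleftrightarrow> i mod int m = j mod int m"
proof -
  obtain g :: "nat \<Rightarrow> 'a" where g: "inj g" using assms infinite_countable_subset by blast
  define \<epsilon> where "\<epsilon> = (\<lambda>i. g (nat (i mod int m)))"
  \<comment> \<open>\<open>\<delta>\<close> reads off the representative in
    \<open>{0..<m}\<close>.\<close>
  define \<delta> where "\<delta> = (\<lambda>x. int (inv_into UNIV g x))"
  define A where "A = \<lparr>carrier = range \<epsilon>, mult = (\<lambda>x y. \<epsilon> (\<delta> x + \<delta> y)), one = \<epsilon> 0\<rparr>"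
  have eq: "\<epsilon> i = \<epsilon> j \<longleftrightarrow> i mod int m = j mod int m" for i j
    using g assms by (auto simp: \<epsilon>_def inj_eq eq_nat_nat_iff)
  have \<delta>: "\<delta> (\<epsilon> i) = i mod int m" for i using g assms by (simp add: \<delta>_def \<epsilon>_def)
  have mult: "\<epsilon> i \<otimes>\<^bsub>A\<^esub> \<epsilon> j = \<epsilon> (i + j)" for i j
    by (simp add: A_def \<delta> eq mod_simps)
  have car: "carrier A = range \<epsilon>" and one: "\<one>\<^bsub>A\<^esub> = \<epsilon> 0" by (simp_all add: A_def)
  have grp: "group A"
  proof (rule groupI)
    show "\<exists>y \<in> carrier A. y \<otimes>\<^bsub>A\<^esub> x = \<one>\<^bsub>A\<^esub>" if "x \<in> carrier A" for x
    proof -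
      from that obtain i where "x = \<epsilon> i" by (auto simp: car)
      then show ?thesis by (intro bexI[of _ "\<epsilon> (- i)"]) (auto simp: car one mult)
    qed
  qed (auto simp: car one mult add.assoc)
  interpret group A by fact
  have inv: "inv\<^bsub>A\<^esub> (\<epsilon> j) = \<epsilon> (- j)" for j
    by (rule inv_equality) (auto simp: car one mult)
  have "range \<epsilon> = g ` {..<m}"
  proof
    show "range \<epsilon> \<subseteq> g ` {..<m}" using assms by (auto simp: \<epsilon>_def nat_less_iff)
    have "g i = \<epsilon> (int i)" if "i < m" for i using that by (simp add: \<epsilon>_def)
    then show "g ` {..<m} \<subseteq> range \<epsilon>" by auto
  qed
  then have card: "card (carrier A) = m" using g by (simp add: car card_image inj_on_subset)
  have "\<epsilon> i \<otimes>\<^bsub>A\<^esub> inv\<^bsub>A\<^esub> (\<epsilon> j) = \<epsilon> (i - j)" for i j by (simp add: inv mult)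
  then show thesis by (rule that[OF grp card car _ eq])
qed

text \<open>Under the constant identity label, a group colouring gives adjacent vertices different
  elements, and a triangle needs three.\<close>

lemma not_colorable_triangle:
  assumes "orientation H D" "group A" "card (carrier A) = 2"
    and "{x, y} \<in> edges H" "{y, z} \<in> edges H" "{x, z} \<in> edges H"
    and "x \<in> verts H" "y \<in> verts H" "z \<in> verts H"
  shows "\<not> group_colorable H D A"
proof
  assume col: "group_colorable H D A"
  interpret group A by fact
  obtain c where c: "group_coloring H D A (\<lambda>_. \<one>\<^bsub>A\<^esub>) c"
    using col unfolding group_colorable_def by auto
  then have mem: "c v \<in> carrier A" if "v \<in> verts H" for v
    using that by (auto simp: group_coloring_def)
  have ne: "c u \<noteq> c v" if "{u, v} \<in> edges H" "u \<in> verts H" "v \<in> verts H" for u v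
  proof -
    have "(u, v) \<in> D \<or> (v, u) \<in> D" using assms(1) that by (auto simp: orientation_def)
    then have "c u \<otimes>\<^bsub>A\<^esub> inv\<^bsub>A\<^esub> (c v) \<noteq> \<one>\<^bsub>A\<^esub> \<or> c v \<otimes>\<^bsub>A\<^esub> inv\<^bsub>A\<^esub> (c u) \<noteq> \<one>\<^bsub>A\<^esub>"
      using c by (auto simp: group_coloring_def)
    then show ?thesis using mem that by auto
  qed
  have "card {c x, c y, c z} = 3" using ne assms by simp
  moreover have "card {c x, c y, c z} \<le> card (carrier A)"
    using assms mem by (intro card_mono) (auto intro: card_ge_0_finite)
  ultimately show False using assms by simp
qed

text \<open>The residues \<open>u\<close>, \<open>u + s\<close>, \<open>u + 2 * s\<close> are all of
  the residues modulo 3, and the first two are excluded for \<open>z\<close>.\<close>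

lemma mod3_step:
  fixes u x y z s :: int
  assumes "s \<in> {1, -1}" "x mod 3 = u mod 3" "y mod 3 = (u + s) mod 3"
    and "y mod 3 \<noteq> z mod 3" "x mod 3 \<noteq> z mod 3"
  shows "z mod 3 = (u + 2 * s) mod 3"
proof -
  define r t where "r = u mod 3" and "t = z mod 3"
  have "r \<in> {0, 1, 2}" "t \<in> {0, 1, 2}" by (auto simp: r_def t_def)
  moreover have "t \<noteq> r" "t \<noteq> (r + s) mod 3" using assms by (auto simp: r_def t_def mod_simps)
  ultimately have "t = (r + 2 * s) mod 3" using assms(1) by (elim insertE emptyE) simp_all
  then show ?thesis by (simp add: r_def t_def mod_simps)
qed

lemma mod3_neq:
  fixes x y :: int
  assumes "x mod 3 \<noteq> y mod 3"
  shows "y mod 3 = (x + 1) mod 3 \<or> y mod 3 = (x + - 1) mod 3"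
proof -
  have "(x + 1) mod 3 = (x mod 3 + 1) mod 3" "(x + - 1) mod 3 = (x mod 3 + - 1) mod 3"
    by (simp_all only: mod_simps)
  moreover have "x mod 3 \<in> {0, 1, 2}" "y mod 3 \<in> {0, 1, 2}" by auto
  ultimately show ?thesis using assms by (elim insertE emptyE) simp_all
qed

text \<open>
  With the label \<open>0\<close> on all edges that do not wrap around, a \<open>\<int>\<^sub>3\<close>-colouring is an arithmetic
  progression with difference \<open>1\<close> or \<open>-1\<close>. One wrapping edge is used to exclude each of the two.
\<close>

lemma mod3_progression:
  fixes d :: "nat \<Rightarrow> int"
  assumes N: "N \<ge> 3"
    and d1: "\<And>i. Suc i < N \<Longrightarrow> d i mod 3 \<noteq> d (Suc i) mod 3"
    and d2: "\<And>i. i + 2 < N \<Longrightarrow> d i mod 3 \<noteq> d (i + 2) mod 3"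
  shows "(\<forall>i < N. d i mod 3 = (d 0 + int i) mod 3) \<or> (\<forall>i < N. d i mod 3 = (d 0 - int i) mod 3)"
proof -
  have prog: "\<forall>i < N. d i mod 3 = (d 0 + s * int i) mod 3"
    if s: "s \<in> {1, -1}" "d 1 mod 3 = (d 0 + s) mod 3" for s
  proof -
    \<comment> \<open>Two consecutive values are carried along, because the next residue is
      determined by the two before it.\<close>
    have "Suc i < N \<Longrightarrow> d i mod 3 = (d 0 + s * int i) mod 3 \<and>
            d (Suc i) mod 3 = (d 0 + s * int (Suc i)) mod 3" for i
    proof (induction i)
      case 0
      then show ?case using s by simp
    next
      case (Suc i)
      then have "d (Suc (Suc i)) mod 3 = (d 0 + s * int (Suc (Suc i))) mod 3"
        using mod3_step[OF s(1), of "d i" "d 0 + s * int i" "d (Suc i)" "d (Suc (Suc i))"]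
          d1[of "Suc i"] d2[of i] by (simp add: algebra_simps)
      with Suc show ?case by simp
    qed
    note step = this
    show ?thesis
    proof (intro allI impI)
      fix i assume "i < N"
      then show "d i mod 3 = (d 0 + s * int i) mod 3"
        using step[of "i - 1"] N by (cases i) auto
    qed
  qed
  have "d 1 mod 3 = (d 0 + 1) mod 3 \<or> d 1 mod 3 = (d 0 + - 1) mod 3"
    using mod3_neq[OF d1[of 0]] N by simp
  then show ?thesis
  proof
    assume "d 1 mod 3 = (d 0 + 1) mod 3"
    then show ?thesis using prog[of 1] by simp
  next
    assume "d 1 mod 3 = (d 0 + - 1) mod 3"
    then show ?thesis using prog[of "- 1"] by simp
  qed
qed

text \<open>The edge from \<open>p 0\<close> to \<open>p (N - 1)\<close> rules out the increasing
  progression, the one to \<open>p (N - 2)\<close> the decreasing one. Injectivity of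
  \<open>p\<close> keeps both apart from the edges labelled zero.\<close>

lemma not_colorable_cycle_square:
  fixes p :: "nat \<Rightarrow> 'v" and A :: "'a monoid" and \<epsilon> :: "int \<Rightarrow> 'a"
  assumes H: "orientation H D" and N: "N \<ge> 6"
    and p: "verts H = p ` {..<N}" "inj_on p {..<N}"
    and adj: "\<And>i j. \<lbrakk>i < j; j < N; j \<le> i + 2 \<or> i + N \<le> j + 2\<rbrakk> \<Longrightarrow> {p i, p j} \<in> edges H"
    and A: "carrier A = range \<epsilon>"
      "\<And>i j. \<epsilon> i \<otimes>\<^bsub>A\<^esub> inv\<^bsub>A\<^esub> (\<epsilon> j) = \<epsilon> (i - j)" "\<And>i j. \<epsilon> i = \<epsilon> j \<longleftrightarrow> i mod 3 = j mod 3"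
  shows "\<not> group_colorable H D A"
proof
  assume col: "group_colorable H D A"
  \<comment> \<open>\<open>t j\<close> is the value that the respective progression forces on
    \<open>d j - d 0\<close>: \<open>N - 1\<close> when increasing, \<open>- (N - 2)\<close> when
    decreasing.\<close>
  define t where "t = (\<lambda>j. if j = N - 1 then int (N - 1) else if j = N - 2 then - int (N - 2) else 0)"
  \<comment> \<open>The sign compensates for the orientation: an edge leaving \<open>p 0\<close>
    constrains the opposite difference.\<close>
  define f where "f = (\<lambda>e. if e = {p 0, p (N - 1)} \<or> e = {p 0, p (N - 2)}
     then let j = (if e = {p 0, p (N - 1)} then N - 1 else N - 2)
          in if (p j, p 0) \<in> D then \<epsilon> (t j) else \<epsilon> (- t j)
     else \<epsilon> 0)"
  have "f \<in> edges H \<rightarrow> carrier A" unfolding A f_def Let_def by simp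
  then obtain c where c: "group_coloring H D A f c"
    using col unfolding group_colorable_def by auto
  then have "\<exists>d. c v = \<epsilon> d" if "v \<in> verts H" for v
    using that A by (auto simp: group_coloring_def)
  then have "\<exists>d. c (p i) = \<epsilon> d" if "i < N" for i using that p by auto
  then obtain d where d: "\<And>i. i < N \<Longrightarrow> c (p i) = \<epsilon> (d i)" by metis
  have D: "(p i, p j) \<in> D \<longleftrightarrow> (p j, p i) \<notin> D" if "{p i, p j} \<in> edges H" for i j
    using H that by (auto simp: orientation_def)
  have ne: "\<epsilon> (d i - d j) \<noteq> f {p i, p j}" if "(p i, p j) \<in> D" "i < N" "j < N" for i j
    using c that d A by (fastforce simp: group_coloring_def)
  have inj: "p i = p j \<longleftrightarrow> i = j" if "i < N" "j < N" for i j
    using p that by (auto simp: inj_on_eq_iff)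
  have d0: "d i mod 3 \<noteq> d j mod 3" if ij: "i < j" "j < N" "j \<le> i + 2" for i j
  proof -
    have "{p i, p j} \<noteq> {p 0, p (N - 1)}" "{p i, p j} \<noteq> {p 0, p (N - 2)}"
      using ij N by (auto simp: doubleton_eq_iff inj)
    then have "f {p i, p j} = \<epsilon> 0" "f {p j, p i} = \<epsilon> 0" by (auto simp: f_def insert_commute)
    moreover have "(p i, p j) \<in> D \<or> (p j, p i) \<in> D" using D adj ij by blast
    ultimately have "\<epsilon> (d i - d j) \<noteq> \<epsilon> 0 \<or> \<epsilon> (d j - d i) \<noteq> \<epsilon> 0"
      using ne[of i j] ne[of j i] ij by auto
    then show ?thesis unfolding A(3) by presburger
  qed
  have wrap: "(d j - d 0) mod 3 \<noteq> t j mod 3" if j: "j \<in> {N - 1, N - 2}" for j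
  proof -
    have e: "{p 0, p j} \<in> edges H" 
  proof (rule adj)
    show "0 < j" "j < N" "j \<le> 0 + 2 \<or> 0 + N \<le> j + 2" using j N by auto
  qed
    have "{p 0, p (N - 1)} \<noteq> {p 0, p (N - 2)}"
      using N by (auto simp: doubleton_eq_iff inj)
    then have f: "f {p 0, p j} = (if (p j, p 0) \<in> D then \<epsilon> (t j) else \<epsilon> (- t j))"
      using j by (auto simp: f_def)
    show ?thesis
    proof (cases "(p j, p 0) \<in> D")
      case True
      then have "\<epsilon> (d j - d 0) \<noteq> \<epsilon> (t j)"
        using ne[of j 0] f j N by (auto simp: insert_commute)
      then show ?thesis unfolding A(3) .
    next
      case False
      then have "\<epsilon> (d 0 - d j) \<noteq> \<epsilon> (- t j)"
        using ne[of 0 j] D[OF e] f j N by auto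
      then show ?thesis unfolding A(3) by presburger
    qed
  qed
  have "(\<forall>i < N. d i mod 3 = (d 0 + int i) mod 3) \<or> (\<forall>i < N. d i mod 3 = (d 0 - int i) mod 3)"
    using N d0 by (intro mod3_progression) auto
  then show False
  proof
    assume "\<forall>i < N. d i mod 3 = (d 0 + int i) mod 3"
    then have "d (N - 1) mod 3 = (d 0 + int (N - 1)) mod 3" using N by simp
    then show False using wrap[of "N - 1"] unfolding t_def by simp presburger
  next
    assume "\<forall>i < N. d i mod 3 = (d 0 - int i) mod 3"
    then have "d (N - 2) mod 3 = (d 0 - int (N - 2)) mod 3" using N by simp
    moreover have "t (N - 2) = - int (N - 2)" using N by (simp add: t_def)
    ultimately show False using wrap[of "N - 2"] by simp presburger
  qed
qed

section \<open>Total graphs of paths and cycles\<close>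

lemma total_edge_iff:
  "{Inl u, Inl v} \<in> edges (total_graph G) \<longleftrightarrow> {u, v} \<in> edges G"
  "{Inl u, Inr e} \<in> edges (total_graph G) \<longleftrightarrow> e \<in> edges G \<and> u \<in> e"
  "{Inr e, Inl u} \<in> edges (total_graph G) \<longleftrightarrow> e \<in> edges G \<and> u \<in> e"
  "{Inr e, Inr e'} \<in> edges (total_graph G) \<longleftrightarrow>
     e \<in> edges G \<and> e' \<in> edges G \<and> e \<noteq> e' \<and> e \<inter> e' \<noteq> {}"
  unfolding total_graph_def by (auto simp: doubleton_eq_iff insert_commute)

definition interleave :: "(nat \<Rightarrow> nat set) \<Rightarrow> nat \<Rightarrow> nat + nat set" where
  "interleave e i = (if even i then Inl (i div 2) else Inr (e (i div 2)))"

lemma interleave_simps [simp]: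
  "interleave e (2 * a) = Inl a" "interleave e (Suc (2 * a)) = Inr (e a)"
  by (simp_all add: interleave_def)

lemma parity_cases:
  fixes i :: nat
  obtains a where "i = 2 * a" | a where "i = Suc (2 * a)"
  using that by (cases "even i") (auto elim!: evenE oddE)

text \<open>There are \<open>n\<close> vertices and \<open>n - 1\<close> edges, so the listing
  begins and ends with a vertex.\<close>

lemma verts_total_path:
  assumes "n \<ge> 2"
  shows "verts (total_graph (path_graph n)) = interleave (\<lambda>i. {i, Suc i}) ` {..<2 * n - 1}"
proof (intro subset_antisym subsetI)
  fix x assume "x \<in> verts (total_graph (path_graph n))"
  then consider a where "a < n" "x = Inl a" | a where "Suc a < n" "x = Inr {a, Suc a}"
    by (auto simp: total_graph_def path_graph_def)
  then show "x \<in> interleave (\<lambda>i. {i, Suc i}) ` {..<2 * n - 1}"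
  proof cases
    case 1
    then show ?thesis by (intro image_eqI[of _ _ "2 * a"]) auto
  next
    case 2
    then show ?thesis by (intro image_eqI[of _ _ "Suc (2 * a)"]) auto
  qed
next
  fix x assume "x \<in> interleave (\<lambda>i. {i, Suc i}) ` {..<2 * n - 1}"
  then obtain i where "i < 2 * n - 1" "x = interleave (\<lambda>i. {i, Suc i}) i" by auto
  then show "x \<in> verts (total_graph (path_graph n))"
    by (cases i rule: parity_cases) (auto simp: total_graph_def path_graph_def)
qed

lemma edges_path: "e \<in> edges (path_graph n) \<longleftrightarrow> (\<exists>i. e = {i, Suc i} \<and> Suc i < n)"
  by (auto simp: path_graph_def)

text \<open>Exchanging \<open>i\<close> and \<open>j\<close> gives the other inequality. This
  direction suffices for paths, whose lower bound rests on a triangle.\<close>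

lemma near_total_path:
  assumes "{interleave (\<lambda>i. {i, Suc i}) i, interleave (\<lambda>i. {i, Suc i}) j} \<in> edges (total_graph (path_graph n))"
  shows "i \<le> j + 2"
  using assms
  by (cases i rule: parity_cases; cases j rule: parity_cases)
    (auto simp: total_edge_iff edges_path doubleton_eq_iff)

section \<open>The total graph of a cycle as the square of a cycle\<close>

text \<open>The case distinction stands for \<open>Suc i mod n\<close> and keeps the later case
  splits within linear arithmetic.\<close>

definition cycle_edge :: "nat \<Rightarrow> nat \<Rightarrow> nat set" where
  "cycle_edge n i = {i, if Suc i = n then 0 else Suc i}"

lemma edges_cycle: "e \<in> edges (cycle_graph n) \<longleftrightarrow> (\<exists>i < n. e = cycle_edge n i)"
proof -
  have "{i, Suc i mod n} = cycle_edge n i" if "i < n" for i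
    using that by (auto simp: cycle_edge_def)
  then show ?thesis unfolding cycle_graph_def by auto
qed

lemma verts_total_cycle:
  "verts (total_graph (cycle_graph n)) = interleave (cycle_edge n) ` {..<2 * n}"
proof (intro subset_antisym subsetI)
  fix x assume "x \<in> verts (total_graph (cycle_graph n))"
  then have "(\<exists>a < n. x = Inl a) \<or> (\<exists>e \<in> edges (cycle_graph n). x = Inr e)"
    by (auto simp: total_graph_def cycle_graph_def)
  then consider a where "a < n" "x = Inl a" | a where "a < n" "x = Inr (cycle_edge n a)"
    by (auto simp: edges_cycle)
  then show "x \<in> interleave (cycle_edge n) ` {..<2 * n}"
  proof cases
    case 1
    then show ?thesis by (intro image_eqI[of _ _ "2 * a"]) auto
  next
    case 2
    then show ?thesis by (intro image_eqI[of _ _ "Suc (2 * a)"]) auto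
  qed
next
  fix x assume "x \<in> interleave (cycle_edge n) ` {..<2 * n}"
  then obtain i where i: "i < 2 * n" "x = interleave (cycle_edge n) i" by auto
  have "cycle_edge n a \<in> edges (cycle_graph n)" if "a < n" for a
    using that edges_cycle by blast
  then show "x \<in> verts (total_graph (cycle_graph n))"
    using i by (cases i rule: parity_cases) (auto simp: total_graph_def cycle_graph_def)
qed

text \<open>The bound on \<open>n\<close> matters: for \<open>n = 2\<close> both edges would be the
  same set.\<close>

lemma cycle_edge_eq_iff:
  assumes "n \<ge> 3" "a < n" "b < n"
  shows "cycle_edge n a = cycle_edge n b \<longleftrightarrow> a = b"
  using assms by (auto simp: cycle_edge_def doubleton_eq_iff split: if_splits)

lemma inj_on_interleave_cycle:
  assumes "n \<ge> 3"
  shows "inj_on (interleave (cycle_edge n)) {..<2 * n}"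
proof (rule inj_onI)
  fix i j assume "i \<in> {..<2 * n}" "j \<in> {..<2 * n}"
    "interleave (cycle_edge n) i = interleave (cycle_edge n) j"
  then show "i = j"
    by (cases i rule: parity_cases; cases j rule: parity_cases)
      (auto simp: cycle_edge_eq_iff[OF assms])
qed

text \<open>Left to right this serves the upper bound, right to left the lower bound. The parities
  of \<open>i\<close> and \<open>j\<close> decide which kind of adjacency in the total graph
  applies.\<close>

lemma total_cycle_edge_iff:
  assumes n: "n \<ge> 3" and ij: "i < 2 * n" "j < 2 * n"
  shows "{interleave (cycle_edge n) i, interleave (cycle_edge n) j} \<in> edges (total_graph (cycle_graph n))
    \<longleftrightarrow> i \<noteq> j \<and> (i \<le> j + 2 \<and> j \<le> i + 2 \<or> i + 2 * n \<le> j + 2 \<or> j + 2 * n \<le> i + 2)"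
proof -
  have E: "cycle_edge n a \<in> edges (cycle_graph n)" if "a < n" for a
    using that edges_cycle by blast
  have vv: "{a, b} \<in> edges (cycle_graph n) \<longleftrightarrow>
      Suc a = b \<or> Suc b = a \<or> Suc a = n \<and> b = 0 \<or> Suc b = n \<and> a = 0" if "a < n" "b < n" for a b
  proof -
    \<comment> \<open>An edge contains its own index, so only the indices \<open>a\<close> and
      \<open>b\<close> can produce \<open>{a, b}\<close>.\<close>
    have "i \<in> cycle_edge n i" for i by (simp add: cycle_edge_def)
    then have "i = a \<or> i = b" if "{a, b} = cycle_edge n i" for i
      using that by (metis insertE singletonD)
    then have "{a, b} \<in> edges (cycle_graph n) \<longleftrightarrow> {a, b} = cycle_edge n a \<or> {a, b} = cycle_edge n b"
      unfolding edges_cycle using that by blast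
    then show ?thesis using that n by (auto simp: cycle_edge_def doubleton_eq_iff)
  qed
  have ve: "a \<in> cycle_edge n b \<longleftrightarrow> a = b \<or> a = Suc b \<or> Suc b = n \<and> a = 0" if "a < n" "b < n" for a b
    using that by (auto simp: cycle_edge_def)
  have ee: "cycle_edge n a \<inter> cycle_edge n b \<noteq> {} \<longleftrightarrow>
      a = b \<or> Suc a = b \<or> Suc b = a \<or> Suc a = n \<and> b = 0 \<or> Suc b = n \<and> a = 0"
    if "a < n" "b < n" for a b
    using that by (auto simp: cycle_edge_def)
  show ?thesis
  proof (cases i rule: parity_cases; cases j rule: parity_cases)
    fix a b assume [simp]: "i = 2 * a" "j = 2 * b"
    show ?thesis using ij n by (simp add: total_edge_iff vv) arith
  next
    fix a b assume [simp]: "i = 2 * a" "j = Suc (2 * b)"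
    show ?thesis using ij n E by (simp add: total_edge_iff ve) arith
  next
    fix a b assume [simp]: "i = Suc (2 * a)" "j = 2 * b"
    show ?thesis using ij n E by (simp add: total_edge_iff ve) arith
  next
    fix a b assume [simp]: "i = Suc (2 * a)" "j = Suc (2 * b)"
    show ?thesis using ij n E by (simp add: total_edge_iff ee cycle_edge_eq_iff) arith
  qed
qed

theorem theorem4:
  assumes "infinite (UNIV :: 'a set)"
  shows "(\<forall>n \<ge> 2. \<forall>D. orientation (total_graph (path_graph n)) D \<longrightarrow>
            total_group_chromatic_number TYPE('a) (path_graph n) D = 3 \<and>
            total_group_choice_number TYPE('a) (path_graph n) D = 3) \<and>
         (\<forall>n \<ge> 3. \<forall>D. orientation (total_graph (cycle_graph n)) D \<longrightarrow>
            total_group_chromatic_number TYPE('a) (cycle_graph n) D = 4 \<and>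
            total_group_choice_number TYPE('a) (cycle_graph n) D = 4)"
proof (rule conjI; intro allI impI)
  fix n :: nat and D
  assume n: "n \<ge> 2" and D: "orientation (total_graph (path_graph n)) D"
  let ?H = "total_graph (path_graph n)" and ?p = "interleave (\<lambda>i. {i, Suc i})"
  have "group_choosable TYPE('a) ?H D 3"
  proof (rule group_choosableI[OF simple_graph_total[OF simple_graph_path] D verts_total_path[OF n]])
    fix L :: "nat \<Rightarrow> 'a set" and K
    assume "correspondence {..<2 * n - 1} L K" "\<And>i. i < 2 * n - 1 \<Longrightarrow> card (L i) = 3"
      and "\<And>i j a b. K i a j b \<Longrightarrow> {?p i, ?p j} \<in> edges ?H"
    then show "\<exists>c. correspondence.proper L K {..<2 * n - 1} c"
      using near_total_path by (intro path_square_colouring) blast+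
  qed
  moreover obtain A :: "'a monoid" where A: "group A" "card (carrier A) = 2"
    by (rule cyclic_group_on_infinite_type[OF assms, of 2]) auto
  moreover have "\<not> group_colorable ?H D A"
  \<comment> \<open>An edge together with its two ends forms a triangle in the total graph.\<close>
  proof (rule not_colorable_triangle[OF D A])
    have e: "{0, Suc 0} \<in> edges (path_graph n)" using n by (auto simp: edges_path)
    then show "{Inl 0, Inr {0, Suc 0}} \<in> edges ?H" "{Inr {0, Suc 0}, Inl (Suc 0)} \<in> edges ?H"
      "{Inl 0, Inl (Suc 0)} \<in> edges ?H" by (auto simp: total_edge_iff)
    have v: "0 \<in> verts (path_graph n)" "Suc 0 \<in> verts (path_graph n)"
      using n by (auto simp: path_graph_def)
    show "Inl 0 \<in> verts ?H" "Inr {0, Suc 0} \<in> verts ?H" "Inl (Suc 0) \<in> verts ?H"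
      using e v by (auto simp: total_graph_def)
  qed
  ultimately show "total_group_chromatic_number TYPE('a) (path_graph n) D = 3 \<and>
    total_group_choice_number TYPE('a) (path_graph n) D = 3"
    using group_numbers_eqI[of ?H D 2 A]
    unfolding total_group_chromatic_number_def total_group_choice_number_def by simp
next
  fix n :: nat and D
  assume n: "n \<ge> 3" and D: "orientation (total_graph (cycle_graph n)) D"
  let ?H = "total_graph (cycle_graph n)" and ?p = "interleave (cycle_edge n)"
  have "group_choosable TYPE('a) ?H D 4"
  proof (rule group_choosableI[OF simple_graph_total[OF simple_graph_cycle[OF n]] D verts_total_cycle])
    fix L :: "nat \<Rightarrow> 'a set" and K
    assume L: "correspondence {..<2 * n} L K" "\<And>i. i < 2 * n \<Longrightarrow> card (L i) = 4"
      and K: "\<And>i j a b. K i a j b \<Longrightarrow> {?p i, ?p j} \<in> edges ?H"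
    show "\<exists>c. correspondence.proper L K {..<2 * n} c"
    \<comment> \<open>With \<open>n \<ge> 3\<close> the cycle of positions has length
      \<open>2 * n \<ge> 6\<close>.\<close>
    proof (rule cycle_square_colouring[OF L(1) _ L(2)])
      show "i \<le> j + 2 \<and> j \<le> i + 2 \<or> i + 2 * n \<le> j + 2 \<or> j + 2 * n \<le> i + 2"
        if "i < 2 * n" "j < 2 * n" "K i a j b" for i j a b
        using total_cycle_edge_iff[OF n that(1,2)] K[OF that(3)] by blast
    qed (use n in auto)
  qed
  moreover obtain A :: "'a monoid" and \<epsilon> where A: "group A" "card (carrier A) = 3"
    "carrier A = range \<epsilon>" "\<And>i j. \<epsilon> i \<otimes>\<^bsub>A\<^esub> inv\<^bsub>A\<^esub> (\<epsilon> j) = \<epsilon> (i - j)"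
    "\<And>i j. \<epsilon> i = \<epsilon> j \<longleftrightarrow> i mod int 3 = j mod int 3"
    by (rule cyclic_group_on_infinite_type[OF assms, of 3]) auto
  moreover have "\<not> group_colorable ?H D A"
  proof (rule not_colorable_cycle_square[OF D _ verts_total_cycle inj_on_interleave_cycle[OF n]])
    show "{?p i, ?p j} \<in> edges ?H" if "i < j" "j < 2 * n" "j \<le> i + 2 \<or> i + 2 * n \<le> j + 2" for i j
      using that by (subst total_cycle_edge_iff[OF n]) auto
  qed (use n A in auto)
  ultimately show "total_group_chromatic_number TYPE('a) (cycle_graph n) D = 4 \<and>
    total_group_choice_number TYPE('a) (cycle_graph n) D = 4"
    using group_numbers_eqI[of ?H D 3 A]
    unfolding total_group_chromatic_number_def total_group_choice_number_def by simp
qed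

end
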